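(* Consider stateless mean field games $\mathcal G=(m,A,\boldsymbol r,\boldsymbol\tau,u)$ with continuous and rate monotonous sojourn-time function $\boldsymbol\tau$ and with power law discounting $u(r,t)=rt^{-\alpha}$, $\alpha\ge0$. 1. For every $\alpha>1$ there exist an instance $\mathcal G$ and a mass distribution $\boldsymbol\mu\in\mathcal U_m(A)$ such that no stationary strategy is a best response of an agent against $\boldsymbol\mu$. 2. For every $0\le\alpha\le1$, every instance $\mathcal G$ and every $\boldsymbol\mu\in\mathcal U_m(A)$, there is a deterministic stationary strategy which is a best response of an agent against $\boldsymbol\mu$.
   Context: Game data: a total mass $m>0$ of nonatomic agents; a finite action set $A=\{1,\dots,n\}$, $n\ge2$; rewards $\boldsymbol r=(r_i)_{i\in A}$, $r_i>0$; for $s>0$ put $\mathcal U_s(A)=\{\boldsymbol\mu\in\mathbb R_{\ge0}^n\mid\sum_{i\in A}\mu_i=s\}$; sojourn-time functions $\tau_i:\bigcup_{s>0}\mathcal U_s(A)\to(0,\infty)$, $\boldsymbol\tau=(\tau_i)_{i\in A}$; a utility function $u(r,t)$ (present value of reward $r$ received at time $t$). The action rates are $x_i(\boldsymbol\mu)=\mu_i/\tau_i(\boldsymbol\mu)$. Continuous and rate monotonous: $\boldsymbol\tau$ is continuous on each $\mathcal U_s(A)$, and for all $\boldsymbol\mu,\boldsymbol\mu'\in\bigcup_{s>0}\mathcal U_s(A)$ and all $i\in A$, $x_i(\boldsymbol\mu)<x_i(\boldsymbol\mu')$ implies $\tau_i(\boldsymbol\mu)\le\tau_i(\boldsymbol\mu')$.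 Strategies: $\mathcal P(A)$ is the set of probability vectors on $A$. A strategy is a sequence $\boldsymbol\sigma=(\sigma_k)_{k\ge1}\in\mathcal P(A)^{\mathbb N}$; the $k$th action $a_k$ is drawn from $\sigma_k$, independently over $k$. It is stationary if $\sigma_k$ does not depend on $k$ (then identified with an element of $\mathcal P(A)$), and deterministic stationary if moreover it always chooses one fixed action $i$. Best response against $\boldsymbol\mu$: write $\tau_i=\tau_i(\boldsymbol\mu)$ and $\theta_k=\sum_{j=1}^k\tau_{a_j}$. - If $\alpha>1$: $\boldsymbol\sigma^*$ is a best response if it maximizes $V(\boldsymbol\sigma,\boldsymbol\tau)=\mathbb E_{\boldsymbol\sigma}\big[\sum_{k=1}^\infty r_{a_k}\theta_k^{-\alpha}\big]$ over $\boldsymbol\sigma\in\mathcal P(A)^{\mathbb N}$. - If $0\le\alpha\le1$, where the total utility diverges, strategies are compared through the leading-order growth of the total utility generated by time $T$, $V_T(\boldsymbol\sigma,\boldsymbol\tau)=\mathbb E_{\boldsymbol\sigma}\big[\sum_{k:\theta_k\le T}r_{a_k}\theta_k^{-\alpha}\big]$: $\boldsymbol\sigma^*$ is a best response if for every strategy $\boldsymbol\sigma$, $\limsup_{T\to\infty}\big(V_T(\boldsymbol\sigma,\boldsymbol\tau)-V_T(\boldsymbol\sigma^*,\boldsymbol\tau)\big)/g(T)\le0$, where $g(T)=T^{1-\alpha}$ if $\alpha<1$ and $g(T)=\log T$ if $\alpha=1$. *)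

theory Defs
  imports "HOL-Probability.Probability"
begin

record stateless_mfg =
  mass :: real
  num_actions :: nat
  reward :: "nat \<Rightarrow> real"
  sojourn :: "nat \<Rightarrow> (nat \<Rightarrow> real) \<Rightarrow> real"
  utility :: "real \<Rightarrow> real \<Rightarrow> real"

definition actions :: "stateless_mfg \<Rightarrow> nat set" where
  "actions G = {1..num_actions G}"

text \<open>A vector indexed by the actions \<open>{1..n}\<close> is a function on \<open>nat\<close> vanishing off \<open>{1..n}\<close>.
  On such functions the topology of \<open>nat \<Rightarrow> real\<close> (pointwise convergence) is the Euclidean topology,
  so \<open>continuous_on\<close> below is ordinary continuity.\<close>

definition mass_distributions :: "nat set \<Rightarrow> real \<Rightarrow> (nat \<Rightarrow> real) set" where
  "mass_distributions A s =
     {\<mu>. (\<forall>i\<in>A. 0 \<le> \<mu> i) \<and> (\<forall>i. i \<notin> A \<longrightarrow> \<mu> i = 0) \<and> (\<Sum>i\<in>A. \<mu> i) = s}"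

definition positive_distributions :: "nat set \<Rightarrow> (nat \<Rightarrow> real) set" where
  "positive_distributions A = (\<Union>s\<in>{0<..}. mass_distributions A s)"

definition game :: "stateless_mfg \<Rightarrow> bool" where
  "game G \<longleftrightarrow>
     mass G > 0 \<and> num_actions G \<ge> 2 \<and>
     (\<forall>i\<in>actions G. reward G i > 0) \<and>
     (\<forall>i\<in>actions G. \<forall>\<mu>\<in>positive_distributions (actions G). sojourn G i \<mu> > 0)"

definition action_rate :: "stateless_mfg \<Rightarrow> nat \<Rightarrow> (nat \<Rightarrow> real) \<Rightarrow> real" where
  "action_rate G i \<mu> = \<mu> i / sojourn G i \<mu>"

definition continuous_sojourn :: "stateless_mfg \<Rightarrow> bool" where
  "continuous_sojourn G \<longleftrightarrow>
     (\<forall>s>0. \<forall>i\<in>actions G. continuous_on (mass_distributions (actions G) s) (sojourn G i))"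

definition rate_monotonous :: "stateless_mfg \<Rightarrow> bool" where
  "rate_monotonous G \<longleftrightarrow>
     (\<forall>\<mu>\<in>positive_distributions (actions G). \<forall>\<mu>'\<in>positive_distributions (actions G).
        \<forall>i\<in>actions G.
          action_rate G i \<mu> < action_rate G i \<mu>' \<longrightarrow> sojourn G i \<mu> \<le> sojourn G i \<mu>')"

definition power_law :: "real \<Rightarrow> real \<Rightarrow> real \<Rightarrow> real" where
  "power_law \<alpha> r t = r * t powr (-\<alpha>)"

text \<open>Sequences are indexed from 0: \<open>\<sigma> k\<close> is the law of the \<open>(k+1)\<close>st action, and \<open>completion_time\<close>
  at \<open>k\<close> is the time at which that action is completed and its reward received.\<close>

definition strategies :: "nat set \<Rightarrow> (nat \<Rightarrow> nat pmf) set" where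
  "strategies A = {\<sigma>. \<forall>k. set_pmf (\<sigma> k) \<subseteq> A}"

definition stationary :: "(nat \<Rightarrow> nat pmf) \<Rightarrow> bool" where
  "stationary \<sigma> \<longleftrightarrow> (\<exists>p. \<forall>k. \<sigma> k = p)"

definition deterministic_stationary :: "(nat \<Rightarrow> nat pmf) \<Rightarrow> bool" where
  "deterministic_stationary \<sigma> \<longleftrightarrow> (\<exists>i. \<forall>k. \<sigma> k = return_pmf i)"

definition action_process :: "(nat \<Rightarrow> nat pmf) \<Rightarrow> (nat \<Rightarrow> nat) measure" where
  "action_process \<sigma> = (\<Pi>\<^sub>M k\<in>UNIV. measure_pmf (\<sigma> k))"

definition completion_time ::
  "stateless_mfg \<Rightarrow> (nat \<Rightarrow> real) \<Rightarrow> (nat \<Rightarrow> nat) \<Rightarrow> nat \<Rightarrow> real" where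
  "completion_time G \<mu> a k = (\<Sum>j\<le>k. sojourn G (a j) \<mu>)"

text \<open>For \<open>\<sigma> \<in> strategies (actions G)\<close> every sojourn time is almost surely at least the positive
  minimum over the finitely many actions. Hence the series below is almost surely bounded by a
  constant when \<open>\<alpha> > 1\<close>, and the sum up to time \<open>T\<close> has almost surely boundedly many terms;
  both integrands are integrable.\<close>

definition total_utility ::
  "stateless_mfg \<Rightarrow> (nat \<Rightarrow> real) \<Rightarrow> (nat \<Rightarrow> nat pmf) \<Rightarrow> real" where
  "total_utility G \<mu> \<sigma> =
     (\<integral>a. (\<Sum>k. utility G (reward G (a k)) (completion_time G \<mu> a k)) \<partial>action_process \<sigma>)"

definition utility_until ::
  "stateless_mfg \<Rightarrow> (nat \<Rightarrow> real) \<Rightarrow> real \<Rightarrow> (nat \<Rightarrow> nat pmf) \<Rightarrow> real" where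
  "utility_until G \<mu> T \<sigma> =
     (\<integral>a. (\<Sum>k | completion_time G \<mu> a k \<le> T.
             utility G (reward G (a k)) (completion_time G \<mu> a k)) \<partial>action_process \<sigma>)"

definition growth :: "real \<Rightarrow> real \<Rightarrow> real" where
  "growth \<alpha> T = (if \<alpha> < 1 then T powr (1 - \<alpha>) else ln T)"

text \<open>Meant for games with \<open>utility G = power_law \<alpha>\<close> and \<open>\<alpha> \<ge> 0\<close>.\<close>

definition best_response ::
  "real \<Rightarrow> stateless_mfg \<Rightarrow> (nat \<Rightarrow> real) \<Rightarrow> (nat \<Rightarrow> nat pmf) \<Rightarrow> bool" where
  "best_response \<alpha> G \<mu> \<sigma>' \<longleftrightarrow>
     \<sigma>' \<in> strategies (actions G) \<and>
     (\<forall>\<sigma>\<in>strategies (actions G).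
        if \<alpha> > 1 then total_utility G \<mu> \<sigma> \<le> total_utility G \<mu> \<sigma>'
        else Limsup at_top (\<lambda>T::real.
               ereal ((utility_until G \<mu> T \<sigma> - utility_until G \<mu> T \<sigma>') / growth \<alpha> T)) \<le> 0)"

end

theory Submission
  imports Defs "HOL-Real_Asymp.Real_Asymp"
begin

text \<open>For \<open>0 \<le> \<alpha> \<le> 1\<close>, always play an action \<open>i\<close> of maximal reward rate \<open>c = r\<^sub>i / \<tau>\<^sub>i\<close>. Since
  \<open>r\<^sub>j \<le> c \<tau>\<^sub>j\<close> for all \<open>j\<close>, the utility until \<open>T\<close> of any path is at most \<open>c\<close> times a right Riemann
  sum of \<open>t powr (-\<alpha>)\<close> over \<open>[0, T]\<close>, while that of the constant path \<open>i\<close> is \<open>c\<close> times a left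
  Riemann sum. Up to their first steps these lie on either side of the integral, so the difference
  of the utilities is bounded, uniformly in \<open>T\<close>, and vanishes after division by the growth.

  For \<open>\<alpha> > 1\<close>, take two actions with \<open>\<tau>\<^sub>i = i\<close> and \<open>r\<^sub>i = i powr \<alpha>\<close>. The two constant paths have
  the same value, and the path \<open>1, 1, 2, 2, 2, \<dots>\<close> has a larger one. If a stationary strategy were
  optimal, no path would exceed its value \<open>v\<close>; but for an action \<open>i\<close> in its support and \<open>M\<close> large,
  the paths that start with \<open>M\<close> times \<open>i\<close> have positive probability and a value close to that of
  the constant path, hence bounded away from \<open>v\<close>, so the expected value would be below \<open>v\<close>.\<close>

section \<open>Integration over the action process\<close>

lemma prob_space_action_process: "prob_space (action_process \<sigma>)"
  unfolding action_process_def by (intro prob_space_PiM prob_space_measure_pmf)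

lemma measurable_action_at [measurable]:
  "(\<lambda>a. a k) \<in> measurable (action_process \<sigma>) (count_space UNIV)"
proof -
  have "(\<lambda>a. a k) \<in> measurable (action_process \<sigma>) (measure_pmf (\<sigma> k))"
    unfolding action_process_def by (rule measurable_component_singleton) simp
  then show ?thesis by (simp cong: measurable_cong_sets)
qed

lemma AE_action_process:
  assumes "\<And>k. set_pmf (\<sigma> k) \<subseteq> B k"
  shows "AE a in action_process \<sigma>. \<forall>k. a k \<in> B k"
proof -
  have "AE a in action_process \<sigma>. a k \<in> B k" for k
    unfolding action_process_def
    using assms[of k]
    by (intro AE_PiM_component prob_space_measure_pmf) (auto simp: AE_measure_pmf_iff)
  then show ?thesis by (simp add: AE_all_countable)
qed

text \<open>The event is a cylinder over the first \<open>M\<close> coordinates, so independence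
  gives the product.\<close>

lemma measure_initial_actions:
  "measure (action_process \<sigma>) {a. \<forall>k<M. a k = i} = (\<Prod>k<M. pmf (\<sigma> k) i)"
proof -
  interpret product_prob_space "\<lambda>k. measure_pmf (\<sigma> k)" UNIV
    by (simp add: product_prob_spaceI prob_space_measure_pmf)
  have "{a. \<forall>k<M. a k = i} =
        prod_emb UNIV (\<lambda>k. measure_pmf (\<sigma> k)) {..<M} (Pi\<^sub>E {..<M} (\<lambda>_. {i}))"
    by (auto simp: prod_emb_def space_PiM fun_eq_iff) metis
  moreover have "prob (prod_emb UNIV (\<lambda>k. measure_pmf (\<sigma> k)) {..<M} (Pi\<^sub>E {..<M} (\<lambda>_. {i})))
      = (\<Prod>k<M. measure (\<sigma> k) {i})"
    by (rule measure_PiM_emb) auto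
  ultimately show ?thesis
    unfolding action_process_def by (simp only: measure_pmf_single)
qed

text \<open>Under point masses the process is almost surely the sequence \<open>b\<close>. This
  makes every fixed path a strategy whose expected payoff is a plain evaluation.\<close>

lemma integral_action_process_return:
  fixes f :: "(nat \<Rightarrow> nat) \<Rightarrow> real"
  assumes "\<And>\<sigma>. f \<in> borel_measurable (action_process \<sigma>)"
  shows "(\<integral>a. f a \<partial>action_process (\<lambda>k. return_pmf (b k))) = f b"
proof -
  let ?P = "action_process (\<lambda>k. return_pmf (b k))"
  interpret prob_space ?P by (rule prob_space_action_process)
  have "AE a in ?P. \<forall>k. a k \<in> {b k}"
    by (rule AE_action_process) simp
  then have "AE a in ?P. f a = f b"
    by eventually_elim (auto intro!: arg_cong[where f = f])
  then have "(\<integral>a. f a \<partial>?P) = (\<integral>a. f b \<partial>?P)"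
    using assms by (intro integral_cong_AE) auto
  then show ?thesis by (simp add: prob_space)
qed

text \<open>A non-integrable function has integral 0 by convention, so a nonnegative bound spares
  any proof of integrability.\<close>

lemma integral_le_nonneg_const:
  fixes f :: "'a \<Rightarrow> real"
  assumes "prob_space M" "AE x in M. f x \<le> C" "0 \<le> C"
  shows "(\<integral>x. f x \<partial>M) \<le> C"
proof (cases "integrable M f")
  case True
  then show ?thesis using prob_space.integral_le_const[OF assms(1)] assms(2) by blast
next
  case False
  then show ?thesis using assms(3) by (simp add: not_integrable_integral_eq)
qed

lemma completion_time_measurable [measurable]:
  "(\<lambda>a. completion_time G \<mu> a k) \<in> borel_measurable (action_process \<sigma>)"
  unfolding completion_time_def by measurable

lemma power_law_term_measurable [measurable]:
  "(\<lambda>a. power_law \<alpha> (reward G (a k)) (completion_time G \<mu> a k))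
     \<in> borel_measurable (action_process \<sigma>)"
  unfolding power_law_def by measurable

text \<open>Meant for measurability: the index set depends on the path, whereas the right-hand side
  uses only countable quantifiers and a series over a fixed index set. The outer 0 is the value of a
  sum over an infinite set.\<close>

lemma sum_Collect_eq_suminf:
  fixes h :: "nat \<Rightarrow> real"
  shows "(\<Sum>k | P k. h k) = (if \<exists>N. \<forall>k. N \<le> k \<longrightarrow> \<not> P k then \<Sum>k. if P k then h k else 0 else 0)"
proof (cases "\<exists>N. \<forall>k. N \<le> k \<longrightarrow> \<not> P k")
  case True
  then obtain N where "\<forall>k. N \<le> k \<longrightarrow> \<not> P k" ..
  then have "{k. P k} \<subseteq> {..<N}" by (auto simp: not_le[symmetric])
  then have fin: "finite {k. P k}" by (rule finite_subset) simp
  have "(\<Sum>k. if P k then h k else 0) = (\<Sum>k | P k. if P k then h k else 0)"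
    by (rule suminf_finite[OF fin]) simp
  then show ?thesis using True by simp
next
  case False
  then have "infinite {k. P k}"
    unfolding infinite_nat_iff_unbounded_le by auto
  then show ?thesis unfolding if_not_P[OF False] by (rule sum.infinite)
qed

lemma power_law_sum_until_measurable:
  "(\<lambda>a. \<Sum>k | completion_time G \<mu> a k \<le> T. power_law \<alpha> (reward G (a k)) (completion_time G \<mu> a k))
     \<in> borel_measurable (action_process \<sigma>)"
  unfolding sum_Collect_eq_suminf by measurable

section \<open>Sums of the power law against its primitive\<close>

text \<open>The divisor turns \<open>growth\<close> into an antiderivative of
  \<open>t powr (-\<alpha>)\<close>, with \<open>ln\<close> at \<alpha> = 1.\<close>

definition growth_primitive :: "real \<Rightarrow> real \<Rightarrow> real" where
  "growth_primitive \<alpha> t = growth \<alpha> t / (if \<alpha> < 1 then 1 - \<alpha> else 1)"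

lemma growth_primitive_deriv:
  assumes "\<alpha> \<le> 1" "0 < t"
  shows "(growth_primitive \<alpha> has_real_derivative t powr (-\<alpha>)) (at t)"
proof (cases "\<alpha> < 1")
  case True
  then have "growth_primitive \<alpha> = (\<lambda>t. t powr (1 - \<alpha>) / (1 - \<alpha>))"
    by (auto simp: growth_primitive_def growth_def)
  then show ?thesis
    using True assms by (auto intro!: derivative_eq_intros)
next
  case False
  then have "\<alpha> = 1" using assms by simp
  then have "growth_primitive \<alpha> = ln"
    by (auto simp: growth_primitive_def growth_def)
  then show ?thesis
    using \<open>\<alpha> = 1\<close> assms by (auto intro!: derivative_eq_intros simp: powr_minus divide_inverse)
qed

text \<open>Mean value theorem, with the derivative nonincreasing: the increment lies between the
  right and left endpoint rectangles.\<close>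

lemma growth_primitive_increment:
  assumes "0 \<le> \<alpha>" "\<alpha> \<le> 1" "0 < x" "x \<le> y"
  shows "(y - x) * y powr (-\<alpha>) \<le> growth_primitive \<alpha> y - growth_primitive \<alpha> x"
    and "growth_primitive \<alpha> y - growth_primitive \<alpha> x \<le> (y - x) * x powr (-\<alpha>)"
proof -
  have "(y - x) * y powr (-\<alpha>) \<le> growth_primitive \<alpha> y - growth_primitive \<alpha> x \<and>
        growth_primitive \<alpha> y - growth_primitive \<alpha> x \<le> (y - x) * x powr (-\<alpha>)"
  proof (cases "x = y")
    case False
    then have "x < y" using assms by simp
    then obtain z where z: "x < z" "z < y"
      "growth_primitive \<alpha> y - growth_primitive \<alpha> x = (y - x) * z powr (-\<alpha>)"
      using MVT2[OF \<open>x < y\<close>, of "growth_primitive \<alpha>" "\<lambda>t. t powr (-\<alpha>)"]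
        growth_primitive_deriv assms by force
    have "y powr (-\<alpha>) \<le> z powr (-\<alpha>)" "z powr (-\<alpha>) \<le> x powr (-\<alpha>)"
      using z assms by (auto intro!: powr_mono2')
    then show ?thesis using z \<open>x < y\<close> by (auto intro!: mult_left_mono)
  qed simp
  then show "(y - x) * y powr (-\<alpha>) \<le> growth_primitive \<alpha> y - growth_primitive \<alpha> x"
    and "growth_primitive \<alpha> y - growth_primitive \<alpha> x \<le> (y - x) * x powr (-\<alpha>)"
    by auto
qed

lemma growth_primitive_mono:
  assumes "0 \<le> \<alpha>" "\<alpha> \<le> 1" "0 < x" "x \<le> y"
  shows "growth_primitive \<alpha> x \<le> growth_primitive \<alpha> y"
  using growth_primitive_increment(1)[OF assms] assms
  by (smt (verit) mult_nonneg_nonneg powr_ge_zero)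

lemma growth_at_top:
  assumes "\<alpha> \<le> 1"
  shows "filterlim (growth \<alpha>) at_top at_top"
proof (cases "\<alpha> < 1")
  case True
  then have "growth \<alpha> = (\<lambda>T. T powr (1 - \<alpha>))" by (auto simp: growth_def)
  moreover have "filterlim (\<lambda>T::real. T powr (1 - \<alpha>)) at_top at_top"
    using True by real_asymp
  ultimately show ?thesis by simp
next
  case False
  then have "growth \<alpha> = ln" by (auto simp: growth_def)
  then show ?thesis by (simp add: ln_at_top)
qed

text \<open>Since the growth tends to infinity, a bound on the difference that is constant in
  \<open>T\<close> suffices.\<close>

lemma Limsup_over_growth_le_0:
  assumes "\<alpha> \<le> 1" and bound: "eventually (\<lambda>T. D T \<le> C) at_top"
  shows "Limsup at_top (\<lambda>T. ereal (D T / growth \<alpha> T)) \<le> 0"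
proof -
  have pos: "eventually (\<lambda>T. growth \<alpha> T > 0) at_top"
    using growth_at_top[OF assms(1)] by (simp add: filterlim_at_top_dense)
  have "((\<lambda>T. C / growth \<alpha> T) \<longlongrightarrow> 0) at_top"
    by (intro tendsto_divide_0[OF tendsto_const] filterlim_at_top_imp_at_infinity
        growth_at_top assms)
  then have "((\<lambda>T. ereal (C / growth \<alpha> T)) \<longlongrightarrow> ereal 0) at_top"
    by (intro tendsto_intros)
  then have "Limsup at_top (\<lambda>T. ereal (C / growth \<alpha> T)) = 0"
    by (simp add: lim_imp_Limsup zero_ereal_def)
  moreover have "Limsup at_top (\<lambda>T. ereal (D T / growth \<alpha> T))
               \<le> Limsup at_top (\<lambda>T. ereal (C / growth \<alpha> T))"
    using bound pos
    by (intro Limsup_mono, eventually_elim) (auto intro: divide_right_mono)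
  ultimately show ?thesis by simp
qed

text \<open>Every rectangle after the first lies below an increment of the primitive, and these
  telescope. The first is estimated separately, because \<open>ln\<close> is unbounded near
  0.\<close>

lemma sum_upto_time_le:
  fixes t :: "nat \<Rightarrow> real"
  assumes "0 \<le> \<alpha>" "\<alpha> \<le> 1" "0 < d" "\<And>k. d \<le> t k" "\<And>k. t k \<le> D" "d \<le> T"
  shows "(\<Sum>k | (\<Sum>j\<le>k. t j) \<le> T. t k * (\<Sum>j\<le>k. t j) powr (-\<alpha>))
           \<le> D powr (1 - \<alpha>) + (growth_primitive \<alpha> T - growth_primitive \<alpha> d)"
proof -
  let ?F = "growth_primitive \<alpha>"
  define \<theta> where "\<theta> k = (\<Sum>j\<le>k. t j)" for k
  have tpos: "0 < t k" for k using assms(3,4) by (meson less_le_trans)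
  have Suc: "\<theta> (Suc k) = \<theta> k + t (Suc k)" for k by (simp add: \<theta>_def)
  have ge: "d \<le> \<theta> k" for k
    by (induction k) (use assms(4) tpos Suc in \<open>auto simp: \<theta>_def add_increasing2 less_imp_le\<close>)
  have th0: "\<theta> 0 = t 0" by (simp add: \<theta>_def)
  have sm: "strict_mono \<theta>" by (rule strict_mono_Suc_iff[THEN iffD2]) (simp add: Suc tpos)
  have step: "(\<Sum>k\<le>n. t k * \<theta> k powr (-\<alpha>)) \<le> D powr (1 - \<alpha>) + (?F (\<theta> n) - ?F d)" for n
  proof (induction n)
    case 0
    have "t 0 * t 0 powr (-\<alpha>) = t 0 powr (1 - \<alpha>)"
      using tpos[of 0] by (simp add: powr_diff powr_minus divide_inverse)
    also have "\<dots> \<le> D powr (1 - \<alpha>)"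
      using assms tpos[of 0] by (intro powr_mono2) auto
    finally show ?case
      using growth_primitive_mono[OF assms(1-3) ge[of 0]] th0 by simp
  next
    case (Suc n)
    have "t (Suc n) * \<theta> (Suc n) powr (-\<alpha>) \<le> ?F (\<theta> (Suc n)) - ?F (\<theta> n)"
      using growth_primitive_increment(1)[OF assms(1,2), of "\<theta> n" "\<theta> (Suc n)"]
        ge[of n] assms(3) tpos[of "Suc n"] \<open>\<And>k. \<theta> (Suc k) = \<theta> k + t (Suc k)\<close>[of n] by simp
    then show ?case using Suc.IH by simp
  qed
  let ?S = "{k. \<theta> k \<le> T}"
  have base: "0 \<le> D powr (1 - \<alpha>) + (?F T - ?F d)"
    using growth_primitive_mono[OF assms(1-3,6)] by simp
  have "(\<Sum>k\<in>?S. t k * \<theta> k powr (-\<alpha>)) \<le> D powr (1 - \<alpha>) + (?F T - ?F d)"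
  \<comment> \<open>Over an empty or infinite index set the sum is 0, and the bound is nonnegative
    because \<open>d \<le> T\<close>.\<close>
  proof (cases "finite ?S \<and> ?S \<noteq> {}")
    case False
    then have "(\<Sum>k\<in>?S. t k * \<theta> k powr (-\<alpha>)) = 0" by (metis sum.empty sum.infinite)
    then show ?thesis using base by simp
  next
    case True
    define n where "n = Max ?S"
    have "n \<in> ?S" using True unfolding n_def by (intro Max_in) auto
    then have n: "\<theta> n \<le> T" by simp
    \<comment> \<open>Completion times increase, so the actions completed by \<open>T\<close> form
      an initial segment.\<close>
    have "?S = {..n}"
    proof (intro equalityI subsetI)
      fix k assume "k \<in> ?S" then show "k \<in> {..n}" using True by (simp add: n_def)
    next
      fix k assume "k \<in> {..n}"
      then have "\<theta> k \<le> \<theta> n" using sm by (simp add: strict_mono_less_eq)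
      then show "k \<in> ?S" using n by simp
    qed
    then show ?thesis
      using step[of n] growth_primitive_mono[OF assms(1,2) _ n] ge[of n] assms(3) by simp
  qed
  then show ?thesis unfolding \<theta>_def .
qed

text \<open>The term at time \<open>(k+1)d\<close> dominates the increment of the primitive over the
  following step, up to \<open>(k+2)d\<close>.\<close>

lemma sum_equidistant_upto_time_ge:
  fixes d :: real
  assumes "0 \<le> \<alpha>" "\<alpha> \<le> 1" "0 < d" "0 < T"
  shows "growth_primitive \<alpha> T - growth_primitive \<alpha> d
           \<le> (\<Sum>k | real (Suc k) * d \<le> T. d * (real (Suc k) * d) powr (-\<alpha>))"
proof -
  let ?F = "growth_primitive \<alpha>"
  \<comment> \<open>The number of actions completed by \<open>T\<close>. Their \<open>n\<close>
    rectangles reach from \<open>d\<close> to \<open>(n+1)d\<close>, which is at least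
    \<open>T\<close>.\<close>
  define n where "n = nat \<lfloor>T / d\<rfloor>"
  have "real (Suc k) * d \<le> T \<longleftrightarrow> Suc k \<le> n" for k
    using assms by (simp add: n_def le_nat_iff le_floor_iff pos_le_divide_eq del: of_nat_Suc)
  then have S: "{k. real (Suc k) * d \<le> T} = {..<n}" by (auto simp: Suc_le_eq)
  have "T / d < real n + 1"
    using assms unfolding n_def by simp
  then have n: "T \<le> real (Suc n) * d" using assms by (simp add: field_simps)
  have "?F (real (Suc m) * d) - ?F d \<le> (\<Sum>k<m. d * (real (Suc k) * d) powr (-\<alpha>))" for m
  proof (induction m)
    case (Suc m)
    have "?F (real (Suc (Suc m)) * d) - ?F (real (Suc m) * d) \<le> d * (real (Suc m) * d) powr (-\<alpha>)"
      using growth_primitive_increment(2)[OF assms(1,2), of "real (Suc m) * d" "real (Suc (Suc m)) * d"]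
        assms(3) by (simp add: algebra_simps add_pos_nonneg)
    then show ?case using Suc by simp
  qed simp
  from this[of n] show ?thesis
    using growth_primitive_mono[OF assms(1,2,4) n] unfolding S by linarith
qed

section \<open>Non-integrable discounting\<close>

lemma best_response_max_reward_rate:
  assumes G: "game G" "utility G = power_law \<alpha>" and \<alpha>: "0 \<le> \<alpha>" "\<alpha> \<le> 1"
    and \<mu>: "\<mu> \<in> mass_distributions (actions G) (mass G)"
    and i: "i \<in> actions G"
    and max: "\<And>j. j \<in> actions G \<Longrightarrow> reward G j / sojourn G j \<mu> \<le> reward G i / sojourn G i \<mu>"
  shows "best_response \<alpha> G \<mu> (\<lambda>_. return_pmf i)"
proof -
  let ?A = "actions G"
  let ?F = "growth_primitive \<alpha>"
  define \<tau> where "\<tau> j = sojourn G j \<mu>" for j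
  define c where "c = reward G i / \<tau> i"
  define d where "d = Min (\<tau> ` ?A)"
  define D where "D = Max (\<tau> ` ?A)"
  have fin: "finite ?A" by (simp add: actions_def)
  have "\<mu> \<in> positive_distributions ?A"
    using \<mu> G(1) by (auto simp: positive_distributions_def game_def)
  then have \<tau>pos: "0 < \<tau> j" if "j \<in> ?A" for j
    using G(1) that by (auto simp: game_def \<tau>_def)
  have dpos: "0 < d" using \<tau>pos fin i unfolding d_def by (subst Min_gr_iff) auto
  have dD: "d \<le> \<tau> j" "\<tau> j \<le> D" if "j \<in> ?A" for j
    using that fin by (auto simp: d_def D_def)
  have c: "0 < c" using G(1) i \<tau>pos[OF i] by (simp add: c_def game_def)
  \<comment> \<open>Maximality of the rate \<open>c\<close> bounds each reward by \<open>c\<close>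
    times the length of its step, which turns payoffs into Riemann sums.\<close>
  have rew: "reward G j \<le> c * \<tau> j" if "j \<in> ?A" for j
    using max[OF that] \<tau>pos[OF that] by (simp add: c_def \<tau>_def pos_divide_le_eq)
  have upper: "utility_until G \<mu> T \<sigma> \<le> c * (D powr (1 - \<alpha>) + (?F T - ?F d))"
    if \<sigma>: "\<sigma> \<in> strategies ?A" and T: "d \<le> T" for \<sigma> T
    unfolding utility_until_def
  proof (rule integral_le_nonneg_const[OF prob_space_action_process])
    show "0 \<le> c * (D powr (1 - \<alpha>) + (?F T - ?F d))"
      using growth_primitive_mono[OF \<alpha> dpos T] c by simp
    have "AE a in action_process \<sigma>. \<forall>k. a k \<in> ?A"
      using \<sigma> by (intro AE_action_process) (auto simp: strategies_def)
    then show "AE a in action_process \<sigma>. (\<Sum>k | completion_time G \<mu> a k \<le> T.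
        utility G (reward G (a k)) (completion_time G \<mu> a k))
          \<le> c * (D powr (1 - \<alpha>) + (?F T - ?F d))"
    proof eventually_elim
      case (elim a)
      have \<theta>: "completion_time G \<mu> a k = (\<Sum>j\<le>k. \<tau> (a j))" for k
        by (simp add: completion_time_def \<tau>_def)
      have "(\<Sum>k | completion_time G \<mu> a k \<le> T.
              utility G (reward G (a k)) (completion_time G \<mu> a k))
          \<le> (\<Sum>k | (\<Sum>j\<le>k. \<tau> (a j)) \<le> T. c * (\<tau> (a k) * (\<Sum>j\<le>k. \<tau> (a j)) powr (-\<alpha>)))"
        unfolding \<theta> G(2) power_law_def
        using rew elim by (intro sum_mono) (auto simp: mult.assoc[symmetric] intro!: mult_right_mono)
      also have "\<dots> = c * (\<Sum>k | (\<Sum>j\<le>k. \<tau> (a j)) \<le> T. \<tau> (a k) * (\<Sum>j\<le>k. \<tau> (a j)) powr (-\<alpha>))"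
        by (simp add: sum_distrib_left)
      also have "\<dots> \<le> c * (D powr (1 - \<alpha>) + (?F T - ?F d))"
        using sum_upto_time_le[OF \<alpha> dpos, of "\<lambda>k. \<tau> (a k)" D T] dD elim T c
        by (intro mult_left_mono) auto
      finally show ?case .
    qed
  qed
  have lower: "c * (?F T - ?F (\<tau> i)) \<le> utility_until G \<mu> T (\<lambda>_. return_pmf i)" if "0 < T" for T
  proof -
    have "utility_until G \<mu> T (\<lambda>_. return_pmf i) =
        (\<Sum>k | completion_time G \<mu> (\<lambda>_. i) k \<le> T.
           power_law \<alpha> (reward G i) (completion_time G \<mu> (\<lambda>_. i) k))"
      unfolding utility_until_def G(2)
      by (rule integral_action_process_return[OF power_law_sum_until_measurable])
    also have "\<dots> = (\<Sum>k | real (Suc k) * \<tau> i \<le> T. c * (\<tau> i * (real (Suc k) * \<tau> i) powr (-\<alpha>)))"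
      using \<tau>pos[OF i] by (simp add: completion_time_def power_law_def c_def flip: \<tau>_def)
    also have "\<dots> = c * (\<Sum>k | real (Suc k) * \<tau> i \<le> T. \<tau> i * (real (Suc k) * \<tau> i) powr (-\<alpha>))"
      by (simp add: sum_distrib_left)
    also have "\<dots> \<ge> c * (?F T - ?F (\<tau> i))"
      using sum_equidistant_upto_time_ge[OF \<alpha> \<tau>pos[OF i] that] c by (intro mult_left_mono) auto
    finally show ?thesis .
  qed
  have "Limsup at_top (\<lambda>T. ereal ((utility_until G \<mu> T \<sigma> -
          utility_until G \<mu> T (\<lambda>_. return_pmf i)) / growth \<alpha> T)) \<le> 0"
    if \<sigma>: "\<sigma> \<in> strategies ?A" for \<sigma>
  proof (rule Limsup_over_growth_le_0[OF \<alpha>(2)])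
    \<comment> \<open>The primitive at \<open>T\<close> cancels between the upper and the lower
      bound; only the contributions of the first steps remain.\<close>
    show "\<forall>\<^sub>F T in at_top. utility_until G \<mu> T \<sigma> - utility_until G \<mu> T (\<lambda>_. return_pmf i)
            \<le> c * (D powr (1 - \<alpha>) + ?F (\<tau> i) - ?F d)"
      using eventually_ge_at_top[of d]
    proof eventually_elim
      case (elim T)
      then show ?case
        using upper[OF \<sigma> elim] lower[of T] dpos by (simp add: algebra_simps)
    qed
  qed
  then show ?thesis
    using \<alpha> i unfolding best_response_def by (auto simp: strategies_def)
qed

lemma deterministic_best_response_exists:
  assumes G: "game G" "utility G = power_law \<alpha>" and \<alpha>: "0 \<le> \<alpha>" "\<alpha> \<le> 1"
    and \<mu>: "\<mu> \<in> mass_distributions (actions G) (mass G)"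
  shows "\<exists>\<sigma>. deterministic_stationary \<sigma> \<and> best_response \<alpha> G \<mu> \<sigma>"
proof -
  have "finite (actions G)" "actions G \<noteq> {}"
    using G(1) by (auto simp: actions_def game_def)
  then obtain i where i: "i \<in> actions G"
    and max: "\<And>j. j \<in> actions G \<Longrightarrow> reward G j / sojourn G j \<mu> \<le> reward G i / sojourn G i \<mu>"
    using obtains_MAX[of "actions G" "\<lambda>j. reward G j / sojourn G j \<mu>"]
    by (metis (no_types, lifting) Max_ge finite_imageI imageI)
  have "best_response \<alpha> G \<mu> (\<lambda>_. return_pmf i)"
    by (rule best_response_max_reward_rate[OF G \<alpha> \<mu> i max])
  moreover have "deterministic_stationary (\<lambda>_. return_pmf i)"
    unfolding deterministic_stationary_def by blast
  ultimately show ?thesis by blast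
qed

section \<open>Integrable discounting\<close>

text \<open>Sojourn times are constant in the mass distribution, so continuity and rate monotonicity
  are immediate and any \<mu> can serve.\<close>

definition linear_game :: "real \<Rightarrow> stateless_mfg" where
  "linear_game \<alpha> = \<lparr>mass = 1, num_actions = 2, reward = (\<lambda>i. real i powr \<alpha>),
     sojourn = (\<lambda>i _. real i), utility = power_law \<alpha>\<rparr>"

text \<open>The payoff in \<open>linear_game\<close> of one realised action sequence, before taking
  expectations.\<close>

definition path_value :: "real \<Rightarrow> (nat \<Rightarrow> nat) \<Rightarrow> real" where
  "path_value \<alpha> a = (\<Sum>k. real (a k) powr \<alpha> * (\<Sum>j\<le>k. real (a j)) powr (-\<alpha>))"

lemma linear_game_admissible:
  "game (linear_game \<alpha>)" "continuous_sojourn (linear_game \<alpha>)" "rate_monotonous (linear_game \<alpha>)"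
  by (auto simp: linear_game_def game_def continuous_sojourn_def rate_monotonous_def actions_def)

lemma path_value_measurable: "path_value \<alpha> \<in> borel_measurable (action_process \<sigma>)"
  unfolding path_value_def by measurable

lemma total_utility_linear_game:
  "total_utility (linear_game \<alpha>) \<mu> \<sigma> = (\<integral>a. path_value \<alpha> a \<partial>action_process \<sigma>)"
  by (simp add: total_utility_def linear_game_def path_value_def completion_time_def power_law_def)

lemma total_utility_linear_game_return:
  "total_utility (linear_game \<alpha>) \<mu> (\<lambda>k. return_pmf (b k)) = path_value \<alpha> b"
  unfolding total_utility_linear_game
  by (rule integral_action_process_return[OF path_value_measurable])

lemma summable_zeta:
  fixes \<alpha> :: real
  assumes "1 < \<alpha>"
  shows "summable (\<lambda>k. real (Suc k) powr (-\<alpha>))"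
  using assms summable_real_powr_iff[of "-\<alpha>"] summable_Suc_iff[of "\<lambda>k. real k powr (-\<alpha>)"] by simp

text \<open>Each action lasts at least 1 and earns at most \<open>2 powr \<alpha>\<close>. This is a
  zeta-series majorant common to all paths.\<close>

lemma path_term_le:
  assumes "0 \<le> \<alpha>" and a: "\<And>k. a k \<in> {1..2::nat}"
  shows "real (a k) powr \<alpha> * (\<Sum>j\<le>k. real (a j)) powr (-\<alpha>)
           \<le> 2 powr \<alpha> * real (Suc k) powr (-\<alpha>)"
proof -
  have "(\<Sum>j\<le>k. 1) \<le> (\<Sum>j\<le>k. real (a j))" using a by (intro sum_mono) auto
  then have "real (Suc k) \<le> (\<Sum>j\<le>k. real (a j))" by simp
  then have "(\<Sum>j\<le>k. real (a j)) powr (-\<alpha>) \<le> real (Suc k) powr (-\<alpha>)"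
    using assms(1) by (intro powr_mono2') auto
  moreover have "real (a k) powr \<alpha> \<le> 2 powr \<alpha>"
    using a[of k] assms(1) by (intro powr_mono2) auto
  ultimately show ?thesis by (intro mult_mono) auto
qed

lemma path_term_summable:
  assumes "1 < \<alpha>" "\<And>k. a k \<in> {1..2::nat}"
  shows "summable (\<lambda>k. real (a k) powr \<alpha> * (\<Sum>j\<le>k. real (a j)) powr (-\<alpha>))"
  using assms path_term_le[of \<alpha> a]
  by (intro summable_comparison_test'[OF summable_mult[OF summable_zeta[OF assms(1)], of "2 powr \<alpha>"]])
    auto

lemma path_term_const:
  assumes "0 < i"
  shows "real i powr \<alpha> * (\<Sum>j\<le>k. real i) powr (-\<alpha>) = real (Suc k) powr (-\<alpha>)"
  using assms by (simp add: powr_mult powr_minus del: of_nat_Suc)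

text \<open>Both constant paths have the value \<open>\<zeta>(\<alpha>)\<close>, whereas the path \<open>1, 1, 2, 2, 2, \<dots>\<close> completes its
  actions at times \<open>1, 2, 4, 6, 8, \<dots>\<close> and collects \<open>1 + 2\<^sup>-\<^sup>\<alpha> + 2\<^sup>-\<^sup>\<alpha> + 3\<^sup>-\<^sup>\<alpha> + \<dots>\<close>.\<close>

lemma path_value_const:
  "0 < i \<Longrightarrow> path_value \<alpha> (\<lambda>_. i) = (\<Sum>k. real (Suc k) powr (-\<alpha>))"
  unfolding path_value_def by (simp only: path_term_const)

lemma path_value_switch:
  assumes "1 < \<alpha>"
  shows "path_value \<alpha> (\<lambda>k. if k < 2 then 1 else 2) =
           (\<Sum>k. real (Suc k) powr (-\<alpha>)) + 2 powr (-\<alpha>)"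
proof -
  let ?b = "\<lambda>k::nat. if k < 2 then 1 else 2 :: nat"
  let ?f = "\<lambda>k. real (?b k) powr \<alpha> * (\<Sum>j\<le>k. real (?b j)) powr (-\<alpha>)"
  \<comment> \<open>The two unit actions together last as long as one action 2, so afterwards the
    path runs on the time grid of the constant path 2.\<close>
  have times: "(\<Sum>j\<le>k + 2. real (?b j)) = 2 * real (Suc (Suc k))" for k
    by (induction k) (auto simp: numeral_2_eq_2)
  have tail: "?f (k + 2) = real (Suc (Suc k)) powr (-\<alpha>)" for k
    unfolding times powr_mult by (simp add: powr_minus flip: powr_mult)
  have "path_value \<alpha> ?b = (\<Sum>k. ?f (k + 2)) + (\<Sum>k<2. ?f k)"
    unfolding path_value_def
    using path_term_summable[OF assms, of ?b] by (intro suminf_split_initial_segment) auto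
  also have "(\<Sum>k<2. ?f k) = 1 + 2 powr (-\<alpha>)"
    by (simp add: numeral_2_eq_2)
  also have "(\<Sum>k. ?f (k + 2)) = (\<Sum>k. real (Suc (Suc k)) powr (-\<alpha>))"
    unfolding tail ..
  \<comment> \<open>The tail lacks only the head 1 of the zeta series, which the first action
    collects; the \<open>2 powr (-\<alpha>)\<close> of the second is surplus.\<close>
  also have "\<dots> = (\<Sum>k. real (Suc k) powr (-\<alpha>)) - 1"
    using suminf_split_head[OF summable_zeta[OF assms]] by simp
  finally show ?thesis by simp
qed

text \<open>The first \<open>M\<close> terms are those of a constant path, and the common majorant
  controls the rest.\<close>

lemma path_value_initial_le:
  assumes "1 < \<alpha>" and a: "\<And>k. a k \<in> {1..2::nat}" and init: "\<And>k. k < M \<Longrightarrow> a k = i"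
  shows "path_value \<alpha> a
           \<le> (\<Sum>k<M. real (Suc k) powr (-\<alpha>)) + 2 powr \<alpha> * (\<Sum>k. real (Suc (k + M)) powr (-\<alpha>))"
proof -
  let ?f = "\<lambda>k. real (a k) powr \<alpha> * (\<Sum>j\<le>k. real (a j)) powr (-\<alpha>)"
  have sf: "summable ?f" by (rule path_term_summable[OF assms(1) a])
  have sz: "summable (\<lambda>k. real (Suc (k + M)) powr (-\<alpha>))"
    using summable_ignore_initial_segment[OF summable_zeta[OF assms(1)]] .
  have "?f k = real (Suc k) powr (-\<alpha>)" if "k < M" for k
  proof -
    have "?f k = real i powr \<alpha> * (\<Sum>j\<le>k. real i) powr (-\<alpha>)"
      using that init by (intro arg_cong2[where f = "(*)"] arg_cong2[where f = "(powr)"] sum.cong) auto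
    also have "\<dots> = real (Suc k) powr (-\<alpha>)"
      using a[of k] init[OF that] by (intro path_term_const) auto
    finally show ?thesis .
  qed
  then have "(\<Sum>k<M. ?f k) = (\<Sum>k<M. real (Suc k) powr (-\<alpha>))" by (intro sum.cong) auto
  moreover have "(\<Sum>k. ?f (k + M)) \<le> (\<Sum>k. 2 powr \<alpha> * real (Suc (k + M)) powr (-\<alpha>))"
    using assms(1)
    by (intro suminf_le path_term_le a summable_ignore_initial_segment[OF sf] summable_mult[OF sz])
      simp
  moreover have "path_value \<alpha> a = (\<Sum>k. ?f (k + M)) + (\<Sum>k<M. ?f k)"
    unfolding path_value_def by (rule suminf_split_initial_segment[OF sf])
  ultimately show ?thesis using suminf_mult[OF sz, of "2 powr \<alpha>"] by simp
qed

text \<open>The expression exceeds the zeta value by \<open>2 powr \<alpha> - 1\<close> times a tail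
  of a convergent series.\<close>

lemma path_value_initial_limit:
  assumes "1 < \<alpha>"
  shows "(\<lambda>M. (\<Sum>k<M. real (Suc k) powr (-\<alpha>)) + 2 powr \<alpha> * (\<Sum>k. real (Suc (k + M)) powr (-\<alpha>)))
           \<longlonglongrightarrow> (\<Sum>k. real (Suc k) powr (-\<alpha>))"
proof -
  let ?z = "\<lambda>k. real (Suc k) powr (-\<alpha>)"
  have "(\<lambda>M. (\<Sum>k<M. ?z k) + 2 powr \<alpha> * (suminf ?z - (\<Sum>k<M. ?z k)))
          \<longlonglongrightarrow> suminf ?z + 2 powr \<alpha> * (suminf ?z - suminf ?z)"
    by (intro tendsto_intros summable_LIMSEQ summable_zeta assms)
  moreover have "(\<Sum>k. ?z (k + M)) = suminf ?z - (\<Sum>k<M. ?z k)" for M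
    using suminf_split_initial_segment[OF summable_zeta[OF assms], of M] by simp
  ultimately show ?thesis by simp
qed

lemma no_stationary_best_response:
  assumes \<alpha>: "1 < \<alpha>" and st: "stationary \<sigma>" and br: "best_response \<alpha> (linear_game \<alpha>) \<mu> \<sigma>"
  shows False
proof -
  let ?P = "action_process \<sigma>"
  let ?\<zeta> = "\<Sum>k. real (Suc k) powr (-\<alpha>)"
  define v where "v = (\<integral>a. path_value \<alpha> a \<partial>?P)"
  interpret P: prob_space ?P by (rule prob_space_action_process)
  have A: "actions (linear_game \<alpha>) = {1..2}" by (simp add: actions_def linear_game_def)
  have supp: "set_pmf (\<sigma> k) \<subseteq> {1..2}" for k
    using br by (auto simp: best_response_def strategies_def A)
  \<comment> \<open>Each path is the outcome of a deterministic, possibly nonstationary strategy,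
    which cannot beat the optimum.\<close>
  have le: "path_value \<alpha> a \<le> v" if "\<And>k. a k \<in> {1..2}" for a
  proof -
    have "(\<lambda>k. return_pmf (a k)) \<in> strategies (actions (linear_game \<alpha>))"
      using that by (auto simp: strategies_def A)
    then have "total_utility (linear_game \<alpha>) \<mu> (\<lambda>k. return_pmf (a k))
                 \<le> total_utility (linear_game \<alpha>) \<mu> \<sigma>"
      using br \<alpha> unfolding best_response_def by metis
    then show ?thesis
      by (simp only: total_utility_linear_game_return) (simp add: total_utility_linear_game v_def)
  qed
  have "?\<zeta> < v"
  proof -
    have "?\<zeta> < path_value \<alpha> (\<lambda>k. if k < 2 then 1 else 2)"
      unfolding path_value_switch[OF \<alpha>] by simp
    also have "\<dots> \<le> v" by (rule le) auto
    finally show ?thesis .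
  qed
  then have "eventually (\<lambda>M. (\<Sum>k<M. real (Suc k) powr (-\<alpha>)) +
      2 powr \<alpha> * (\<Sum>k. real (Suc (k + M)) powr (-\<alpha>)) < v) sequentially"
    by (rule order_tendstoD(2)[OF path_value_initial_limit[OF \<alpha>]])
  then obtain M where M: "(\<Sum>k<M. real (Suc k) powr (-\<alpha>)) +
      2 powr \<alpha> * (\<Sum>k. real (Suc (k + M)) powr (-\<alpha>)) < v"
    by (auto simp: eventually_sequentially)
  \<comment> \<open>The guaranteed shortfall below \<open>v\<close> of every path that starts with
    \<open>M\<close> equal actions.\<close>
  define \<delta> where "\<delta> = v - ((\<Sum>k<M. real (Suc k) powr (-\<alpha>)) +
      2 powr \<alpha> * (\<Sum>k. real (Suc (k + M)) powr (-\<alpha>)))"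
  have \<delta>: "0 < \<delta>" using M by (simp add: \<delta>_def)
  \<comment> \<open>Stationarity enters here: one action \<open>i\<close> has the same positive
    probability at every step, so \<open>M\<close> repetitions of it have positive
    probability.\<close>
  obtain p where p: "\<And>k. \<sigma> k = p" using st by (auto simp: stationary_def)
  obtain i where i: "i \<in> set_pmf p" using set_pmf_not_empty[of p] by blast
  define E where "E = {a::nat \<Rightarrow> nat. \<forall>k<M. a k = i}"
  have "{a \<in> space ?P. \<forall>k<M. a k = i} \<in> sets ?P" by measurable
  then have E: "E \<in> sets ?P"
    by (simp add: E_def action_process_def space_PiM)
  have pos: "0 < measure ?P E"
    unfolding E_def measure_initial_actions p using i by (simp add: pmf_positive)
  have nonneg: "0 \<le> path_value \<alpha> a" if "\<And>k. a k \<in> {1..2}" for a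
    unfolding path_value_def
    using path_term_summable[OF \<alpha>, of a] that by (intro suminf_nonneg) auto
  have AE: "AE a in ?P. \<forall>k. a k \<in> {1..2}" by (rule AE_action_process[OF supp])
  have int: "integrable ?P (path_value \<alpha>)"
  proof (rule P.integrable_const_bound[where B = v, OF _ path_value_measurable])
    show "AE a in ?P. norm (path_value \<alpha> a) \<le> v"
      using AE by eventually_elim (use nonneg le in auto)
  qed
  \<comment> \<open>No path exceeds \<open>v\<close>, and those in \<open>E\<close> fall short by
    \<delta>; averaging would put the mean \<open>v\<close> strictly below itself.\<close>
  have "v \<le> (\<integral>a. v - \<delta> * indicator E a \<partial>?P)"
  proof -
    have "AE a in ?P. path_value \<alpha> a \<le> v - \<delta> * indicator E a"
      using AE
    proof eventually_elim
      case (elim a)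
      show ?case
      proof (cases "a \<in> E")
        case True
        then have "path_value \<alpha> a \<le> v - \<delta>"
          using path_value_initial_le[OF \<alpha>, of a M i] elim by (simp add: E_def \<delta>_def)
        then show ?thesis using True by simp
      next
        case False
        then show ?thesis using le elim by simp
      qed
    qed
    then have "(\<integral>a. path_value \<alpha> a \<partial>?P) \<le> (\<integral>a. v - \<delta> * indicator E a \<partial>?P)"
      using int E by (intro integral_mono_AE) (auto intro!: integrable_real_mult_indicator)
    then show ?thesis by (simp only: v_def)
  qed
  also have "\<dots> = v - \<delta> * measure ?P E"
    using P.prob_space E
    by (subst Bochner_Integration.integral_diff) (auto simp: P.emeasure_eq_measure)
  also have "\<dots> < v" using \<delta> pos by simp
  finally show False by simp
qed

theorem proposition3:
  shows "(\<forall>\<alpha>::real. \<alpha> > 1 \<longrightarrow>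
           (\<exists>G. game G \<and> continuous_sojourn G \<and> rate_monotonous G \<and> utility G = power_law \<alpha> \<and>
             (\<exists>\<mu>\<in>mass_distributions (actions G) (mass G).
                \<nexists>\<sigma>. stationary \<sigma> \<and> best_response \<alpha> G \<mu> \<sigma>)))
       \<and> (\<forall>\<alpha>::real. 0 \<le> \<alpha> \<and> \<alpha> \<le> 1 \<longrightarrow>
           (\<forall>G. game G \<and> continuous_sojourn G \<and> rate_monotonous G \<and> utility G = power_law \<alpha> \<longrightarrow>
             (\<forall>\<mu>\<in>mass_distributions (actions G) (mass G).
                \<exists>\<sigma>. deterministic_stationary \<sigma> \<and> best_response \<alpha> G \<mu> \<sigma>)))"
proof (intro conjI allI impI ballI)
  fix \<alpha> :: real
  assume "1 < \<alpha>"
  define \<mu> :: "nat \<Rightarrow> real" where "\<mu> = (\<lambda>i. if i = 1 then 1 else 0)"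
  have "\<mu> \<in> mass_distributions (actions (linear_game \<alpha>)) (mass (linear_game \<alpha>))"
    by (auto simp: mass_distributions_def linear_game_def actions_def \<mu>_def)
  moreover have "\<nexists>\<sigma>. stationary \<sigma> \<and> best_response \<alpha> (linear_game \<alpha>) \<mu> \<sigma>"
    using no_stationary_best_response[OF \<open>1 < \<alpha>\<close>] by blast
  moreover have "utility (linear_game \<alpha>) = power_law \<alpha>" by (simp add: linear_game_def)
  ultimately show "\<exists>G. game G \<and> continuous_sojourn G \<and> rate_monotonous G \<and> utility G = power_law \<alpha> \<and>
      (\<exists>\<mu>\<in>mass_distributions (actions G) (mass G). \<nexists>\<sigma>. stationary \<sigma> \<and> best_response \<alpha> G \<mu> \<sigma>)"
    using linear_game_admissible by blast
next
  fix \<alpha> G \<mu>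
  assume "0 \<le> \<alpha> \<and> \<alpha> \<le> (1::real)"
    and "game G \<and> continuous_sojourn G \<and> rate_monotonous G \<and> utility G = power_law \<alpha>"
    and "\<mu> \<in> mass_distributions (actions G) (mass G)"
  then show "\<exists>\<sigma>. deterministic_stationary \<sigma> \<and> best_response \<alpha> G \<mu> \<sigma>"
    by (intro deterministic_best_response_exists) auto
qed

end
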